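(* Every sink-free digraph $D$ that has a good quasi-kernel has a quasi-kernel of size at most $|V(D)|/2$.
   Context: A quasi-kernel of a digraph $D$ is an independent set $Q\subseteq V(D)$ such that for every vertex $v\in V(D)\setminus Q$ there is a directed path with one or two arcs from $v$ to some vertex of $Q$. A quasi-kernel $Q$ is good if for each $u\in Q$ there is an arc from $u$ to a vertex which is an in-neighbour of some vertex of $Q$. $D$ is sink-free if every vertex has an out-neighbour. *)

theory Defs
  imports Complex_Main "Graph_Theory.Arc_Walk"
begin

definition independent_set :: "('a, 'b) pre_digraph \<Rightarrow> 'a set \<Rightarrow> bool" where
  "independent_set D S \<longleftrightarrow> S \<subseteq> verts D \<and> (\<forall>u\<in>S. \<forall>v\<in>S. \<not> u \<rightarrow>\<^bsub>D\<^esub> v)"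

definition quasi_kernel :: "('a, 'b) pre_digraph \<Rightarrow> 'a set \<Rightarrow> bool" where
  "quasi_kernel D Q \<longleftrightarrow> independent_set D Q \<and>
     (\<forall>v \<in> verts D - Q. \<exists>q\<in>Q. \<exists>p. pre_digraph.apath D v p q \<and> length p \<in> {1, 2})"

(* The vertex w below may be u itself, i.e. u may lie on a directed 2-cycle. *)
definition good_quasi_kernel :: "('a, 'b) pre_digraph \<Rightarrow> 'a set \<Rightarrow> bool" where
  "good_quasi_kernel D Q \<longleftrightarrow> quasi_kernel D Q \<and>
     (\<forall>u\<in>Q. \<exists>v. u \<rightarrow>\<^bsub>D\<^esub> v \<and> (\<exists>w\<in>Q. v \<rightarrow>\<^bsub>D\<^esub> w))"

definition sink_free :: "('a, 'b) pre_digraph \<Rightarrow> bool" where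
  "sink_free D \<longleftrightarrow> (\<forall>v \<in> verts D. \<exists>w. v \<rightarrow>\<^bsub>D\<^esub> w)"

end

theory Submission
  imports Defs
begin

text \<open>Let \<open>Q\<close> be a good quasi-kernel and \<open>A\<close> the set of its in-neighbours, which is disjoint from \<open>Q\<close>.
  Choose for each \<open>a \<in> A\<close> an out-neighbour \<open>f a \<in> Q\<close> and put \<open>Q' = f ` A\<close>. Every walk of length two
  into \<open>Q\<close> passes through \<open>A\<close>, so it can be redirected into \<open>Q'\<close>; by goodness this also applies to the
  vertices of \<open>Q - Q'\<close>. Since \<open>Q'\<close> and \<open>A\<close> are disjoint and \<open>card Q' \<le> card A\<close>, the quasi-kernel
  \<open>Q'\<close> has size at most \<open>card (verts D) / 2\<close>.\<close>

text \<open>Lets the path condition in \<open>quasi_kernel\<close> be checked by adjacency alone.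
  Without loops, the middle vertex of a two-arc walk differs from both ends, so the walk is a path
  as soon as \<open>u \<noteq> v\<close>.\<close>

lemma (in loopfree_digraph) short_apath_iff:
  "(\<exists>p. apath u p v \<and> length p \<in> {1, 2}) \<longleftrightarrow>
     u \<noteq> v \<and> (u \<rightarrow>\<^bsub>G\<^esub> v \<or> (\<exists>w. u \<rightarrow>\<^bsub>G\<^esub> w \<and> w \<rightarrow>\<^bsub>G\<^esub> v))"
  (is "?L \<longleftrightarrow> ?R")
proof
  assume ?L
  then obtain p where p: "apath u p v" "length p \<in> {1, 2}" by blast
  then consider e where "p = [e]" | e f where "p = [e, f]"
    by (auto simp: length_Suc_conv numeral_2_eq_2)
  then show ?R
  proof cases
    case (1 e)
    then have "e \<in> arcs G" "tail G e = u" "head G e = v" "u \<noteq> v"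
      using p(1) by (auto simp: apath_simps)
    then show ?thesis using in_arcs_imp_in_arcs_ends by blast
  next
    case (2 e f)
    then have "e \<in> arcs G" "f \<in> arcs G" "tail G e = u" "head G e = tail G f" "head G f = v" "u \<noteq> v"
      using p(1) by (auto simp: apath_simps)
    then show ?thesis using in_arcs_imp_in_arcs_ends by metis
  qed
next
  assume R: ?R
  then consider e where "e \<in> arcs G" "tail G e = u" "head G e = v"
    | e f where "e \<in> arcs G" "f \<in> arcs G" "tail G e = u" "head G e = tail G f" "head G f = v"
    by (auto simp: arcs_ends_conv)
  then show ?L
  proof cases
    case (1 e)
    then have "apath u [e] v" using R by (auto simp: apath_simps)
    then show ?thesis by (intro exI[of _ "[e]"]) simp
  next
    case (2 e f)
    then have "apath u [e, f] v"
      using R no_loops[of e] no_loops[of f] by (auto simp: apath_simps)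
    then show ?thesis by (intro exI[of _ "[e, f]"]) simp
  qed
qed

theorem theorem5:
  fixes D :: "('a, 'b) pre_digraph"
  assumes "digraph D"
    and "sink_free D"
    and "\<exists>Q. good_quasi_kernel D Q"
  shows "\<exists>Q. quasi_kernel D Q \<and> real (card Q) \<le> real (card (verts D)) / 2"
proof -
  interpret digraph D by fact
  obtain Q where good: "good_quasi_kernel D Q" using assms(3) by blast
  then have Q: "Q \<subseteq> verts D" "\<And>u v. u \<in> Q \<Longrightarrow> v \<in> Q \<Longrightarrow> \<not> u \<rightarrow>\<^bsub>D\<^esub> v"
    by (auto simp: good_quasi_kernel_def quasi_kernel_def independent_set_def)
  define A where "A = {a. \<exists>q\<in>Q. a \<rightarrow>\<^bsub>D\<^esub> q}"
  have near: "v \<in> A \<or> (\<exists>w\<in>A. v \<rightarrow>\<^bsub>D\<^esub> w)" if "v \<in> verts D" for v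
  proof (cases "v \<in> Q")
    case True
    then show ?thesis using good unfolding good_quasi_kernel_def A_def by blast
  next
    case False
    then have "\<exists>q\<in>Q. \<exists>p. apath v p q \<and> length p \<in> {1, 2}"
      using good that unfolding good_quasi_kernel_def quasi_kernel_def by blast
    then show ?thesis unfolding short_apath_iff A_def by blast
  qed
  have A: "A \<subseteq> verts D" "A \<inter> Q = {}"
    using Q adj_in_verts(1) by (auto simp: A_def)
  have "\<forall>a\<in>A. \<exists>q. q \<in> Q \<and> a \<rightarrow>\<^bsub>D\<^esub> q" by (auto simp: A_def)
  then obtain f where f: "\<And>a. a \<in> A \<Longrightarrow> f a \<in> Q \<and> a \<rightarrow>\<^bsub>D\<^esub> f a"
    by (auto dest!: bchoice)
  have fin: "finite A" using A(1) finite_verts finite_subset by blast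
  have sub: "f ` A \<subseteq> Q" using f by blast
  have "independent_set D (f ` A)"
    using sub Q unfolding independent_set_def by blast
  moreover have "\<exists>q\<in>f ` A. \<exists>p. apath v p q \<and> length p \<in> {1, 2}" if "v \<in> verts D - f ` A" for v
  proof -
    from near[of v] that consider "v \<in> A" | w where "w \<in> A" "v \<rightarrow>\<^bsub>D\<^esub> w" by blast
    \<comment> \<open>Take \<open>a = v\<close> in the first case, giving one arc to
      \<open>f a\<close>, and \<open>a = w\<close> in the second, giving two.\<close>
    then obtain a where "a \<in> A" "v \<rightarrow>\<^bsub>D\<^esub> f a \<or> (\<exists>w. v \<rightarrow>\<^bsub>D\<^esub> w \<and> w \<rightarrow>\<^bsub>D\<^esub> f a)"
      using f by cases blast+
    \<comment> \<open>This rules out a closed walk \<open>v\<close>, \<open>w\<close>,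
      \<open>v\<close> along a 2-cycle, which is not a path: \<open>f a\<close> lies in the image,
      \<open>v\<close> does not.\<close>
    moreover from this have "v \<noteq> f a" using that by blast
    ultimately show ?thesis unfolding short_apath_iff by blast
  qed
  ultimately have "quasi_kernel D (f ` A)" by (simp add: quasi_kernel_def)
  moreover have "card (f ` A) + card A \<le> card (verts D)"
  proof -
    have "card (f ` A) + card A = card (f ` A \<union> A)"
      using sub A(2) fin by (subst card_Un_disjoint) auto
    also have "\<dots> \<le> card (verts D)"
      using sub Q(1) A(1) by (intro card_mono) auto
    finally show ?thesis .
  qed
  then have "real (card (f ` A)) \<le> real (card (verts D)) / 2"
    using card_image_le[OF fin, of f] by linarith
  ultimately show ?thesis by blast
qed

end
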